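(* Let $1<p<\infty$ with conjugate exponent $q$, and let $\{\Lambda_\omega\}_{\omega\in\Omega}$ be a Bochner $pg$-frame for $X$ with respect to $\{H_\omega\}_{\omega\in\Omega}$, with synthesis operator $T$ and analysis operator $U$. Let $R_U$ be the range of $U$ and let $\tilde U:R_U\to X$ be the inverse of $U$ on $R_U$. Then $\|T\|$ is the optimal upper Bochner $pg$-frame bound of $\{\Lambda_\omega\}_{\omega\in\Omega}$ and $\dfrac{1}{\|\tilde U\|}$ is the optimal lower Bochner $pg$-frame bound of $\{\Lambda_\omega\}_{\omega\in\Omega}$.
   Context: $X$ is a Banach space, $(\Omega,\Sigma,\mu)$ is a measure space with $\mu$ a positive measure, and $\{H_\omega\}_{\omega\in\Omega}$ is a family of Hilbert spaces. $B(X,H_\omega)$ is the space of bounded linear operators from $X$ to $H_\omega$. Put $K=\oplus_{\omega\in\Omega}H_\omega$ (Hilbert space direct sum), with each $H_\omega$ regarded as a subspace of $K$. A function $f$ from $\Omega$ to a Banach space is Bochner measurable if there are simple functions $f_n$ with $\|f_n(\omega)-f(\omega)\|\to0$ for $\mu$-a.e. $\omega$. For $1\le r<\infty$, $L^r(\mu,K)$ is the Bochner space of (classes of) Bochner measurable $F:\Omega\to K$ with $\|F\|_r=(\int_\Omega\|F(\omega)\|^r d\mu(\omega))^{1/r}<\infty$. Pairing: $\nu:K\to K^*$ is a fixed isometric (linear) isomorphism between $K$ and $K^*$, and for $u,v\in K$, $\langle u,v\rangle:=\nu(v)(u)$ (not the inner product). For $F\in L^p(\mu,K)$, $G\in L^q(\mu,K)$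 with $\frac1p+\frac1q=1$, $\langle F,G\rangle:=\int_\Omega\langle F(\omega),G(\omega)\rangle d\mu(\omega)$; this identifies $L^q(\mu,K)$ isometrically with $(L^p(\mu,K))^*$. For $x\in X$, $x^*\in X^*$, $\langle x,x^*\rangle=x^*(x)$. Bochner $pg$-frame ($1<p<\infty$): a family $\{\Lambda_\omega\in B(X,H_\omega)\}_{\omega\in\Omega}$ is a Bochner $pg$-frame for $X$ with respect to $\{H_\omega\}_{\omega\in\Omega}$ if (i) for each $x\in X$, $\omega\mapsto\Lambda_\omega(x)$ is Bochner measurable, and (ii) there are positive constants $A,B$ with $A\|x\|\le(\int_\Omega\|\Lambda_\omega(x)\|^p d\mu(\omega))^{1/p}\le B\|x\|$ for all $x\in X$. $A$ and $B$ are called lower and upper Bochner $pg$-frame bounds; the optimal lower bound is the largest possible $A$ and the optimal upper bound is the smallest possible $B$. The synthesis operator $T:L^q(\mu,K)\to X^*$ and the analysis operator $U:X\to L^p(\mu,K)$ are defined by $\langle x,TG\rangle=\int_\Omega\langle\Lambda_\omega(x),G(\omega)\rangle d\mu(\omega)=\langle Ux,G\rangle$ for $x\in X$, $G\in L^q(\mu,K)$. For a Bochner $pg$-frame, $U$ is bounded below, so its inverse on $R_U$ exists and is bounded. *)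

theory Defs
  imports "HOL-Analysis.Analysis"
begin

text \<open>
  The scalar field is a type of class \<open>real_normed_field\<close> and \<open>euclidean_space\<close>. Up to isometric
  isomorphism the only such fields are the real and the complex numbers, so everything below covers
  both real and complex spaces. In both cases the real part of a scalar is its inner product
  with 1, which gives a uniform expression for conjugation.
\<close>

definition scalar_cnj :: "'f::{real_normed_field,euclidean_space} \<Rightarrow> 'f" where
  "scalar_cnj a = of_real (2 * (a \<bullet> 1)) - a"

lemma scalar_cnj_real: "scalar_cnj (a::real) = a"
  by (simp add: scalar_cnj_def)

lemma scalar_cnj_complex: "scalar_cnj (a::complex) = cnj a"
  by (simp add: scalar_cnj_def complex_eq_iff inner_complex_def)

locale normed_space_over = vector_space scale
  for scale :: "'f::{real_normed_field,euclidean_space} \<Rightarrow> 'a::real_normed_vector \<Rightarrow> 'a" +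
  assumes norm_scale: "norm (scale a x) = norm a * norm x"
    and scale_of_real: "scale (of_real r) x = r *\<^sub>R x"

locale hilbert_space_over = normed_space_over scale
  for scale :: "'f::{real_normed_field,euclidean_space} \<Rightarrow> 'k::banach \<Rightarrow> 'k" +
  fixes ip :: "'k \<Rightarrow> 'k \<Rightarrow> 'f"
  assumes ip_add_left: "ip (u + v) w = ip u w + ip v w"
    and ip_scale_left: "ip (scale a u) v = a * ip u v"
    and ip_cnj: "ip v u = scalar_cnj (ip u v)"
    and ip_self: "ip u u = of_real ((norm u)\<^sup>2)"

text \<open>
  Internal Hilbert direct sum: the whole type \<open>'k\<close> is the Hilbert space direct sum of its mutually
  orthogonal closed subspaces \<open>H i\<close>, \<open>i \<in> I\<close>.
\<close>

locale hilbert_direct_sum = hilbert_space_over scale ip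
  for scale :: "'f::{real_normed_field,euclidean_space} \<Rightarrow> 'k::banach \<Rightarrow> 'k"
    and ip :: "'k \<Rightarrow> 'k \<Rightarrow> 'f" +
  fixes I :: "'i set" and H :: "'i \<Rightarrow> 'k set"
  assumes subspace_H: "i \<in> I \<Longrightarrow> subspace (H i)"
    and closed_H: "i \<in> I \<Longrightarrow> closed (H i)"
    and orthogonal_H: "\<lbrakk>i \<in> I; j \<in> I; i \<noteq> j; u \<in> H i; v \<in> H j\<rbrakk> \<Longrightarrow> ip u v = 0"
    and dense_H: "closure (span (\<Union>i\<in>I. H i)) = UNIV"

text \<open>
  The type \<open>'a \<Rightarrow>\<^sub>L 'b\<close> consists of the bounded real-linear maps; those linear over the scalar
  field are singled out. The dual carries the operator norm of \<open>'a \<Rightarrow>\<^sub>L 'f\<close>.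
\<close>

definition bounded_ops ::
  "('f \<Rightarrow> 'a::real_normed_vector \<Rightarrow> 'a) \<Rightarrow> ('f \<Rightarrow> 'b::real_normed_vector \<Rightarrow> 'b) \<Rightarrow> ('a \<Rightarrow>\<^sub>L 'b) set" where
  "bounded_ops s t = {L. \<forall>a x. blinfun_apply L (s a x) = t a (blinfun_apply L x)}"

definition dual_space ::
  "('f::{real_normed_field,euclidean_space} \<Rightarrow> 'a::real_normed_vector \<Rightarrow> 'a) \<Rightarrow> ('a \<Rightarrow>\<^sub>L 'f) set" where
  "dual_space s = bounded_ops s (*)"

definition dual_isometry ::
  "('f::{real_normed_field,euclidean_space} \<Rightarrow> 'k::real_normed_vector \<Rightarrow> 'k) \<Rightarrow> ('k \<Rightarrow> 'k \<Rightarrow>\<^sub>L 'f) \<Rightarrow> bool" where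
  "dual_isometry s \<nu> \<longleftrightarrow>
     (\<forall>u v. \<nu> (u + v) = \<nu> u + \<nu> v) \<and>
     (\<forall>a u w. blinfun_apply (\<nu> (s a u)) w = a * blinfun_apply (\<nu> u) w) \<and>
     (\<forall>u. norm (\<nu> u) = norm u) \<and>
     range \<nu> = dual_space s"

definition bochner_measurable :: "'w measure \<Rightarrow> ('w \<Rightarrow> 'b::real_normed_vector) \<Rightarrow> bool" where
  "bochner_measurable M f \<longleftrightarrow>
     (\<exists>s. (\<forall>n. simple_function M (s n)) \<and>
          (AE \<omega> in M. (\<lambda>n::nat. norm (s n \<omega> - f \<omega>)) \<longlonglongrightarrow> 0))"

text \<open>
  A Bochner measurable function is only almost everywhere equal to a measurable one. This does not
  affect the nonnegative integral, which depends only on the almost everywhere class of its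
  integrand, even a non-measurable one.
\<close>

definition eLp_norm :: "'w measure \<Rightarrow> real \<Rightarrow> ('w \<Rightarrow> 'b::real_normed_vector) \<Rightarrow> ennreal" where
  "eLp_norm M r F =
     (let J = (\<integral>\<^sup>+ \<omega>. ennreal (norm (F \<omega>) powr r) \<partial>M)
      in if J = \<infinity> then \<infinity> else ennreal (enn2real J powr (1 / r)))"

definition ae_class :: "'w measure \<Rightarrow> ('w \<Rightarrow> 'b::real_normed_vector) \<Rightarrow> ('w \<Rightarrow> 'b) set" where
  "ae_class M F = {G. bochner_measurable M G \<and> (AE \<omega> in M. G \<omega> = F \<omega>)}"

definition Lp_space :: "'w measure \<Rightarrow> real \<Rightarrow> ('w \<Rightarrow> 'b::real_normed_vector) set set" where
  "Lp_space M r = ae_class M ` {F. bochner_measurable M F \<and> eLp_norm M r F < \<infinity>}"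

definition rep :: "('w \<Rightarrow> 'b) set \<Rightarrow> 'w \<Rightarrow> 'b" where
  "rep C = (SOME F. F \<in> C)"

definition Lp_norm :: "'w measure \<Rightarrow> real \<Rightarrow> ('w \<Rightarrow> 'b::real_normed_vector) set \<Rightarrow> real" where
  "Lp_norm M r C = enn2real (eLp_norm M r (rep C))"

definition op_norm :: "'a set \<Rightarrow> ('a \<Rightarrow> real) \<Rightarrow> ('b \<Rightarrow> real) \<Rightarrow> ('a \<Rightarrow> 'b) \<Rightarrow> real" where
  "op_norm S nS nT L = (SUP v\<in>{v \<in> S. nS v \<le> 1}. nT (L v))"

definition lower_pg_bound ::
  "'w measure \<Rightarrow> real \<Rightarrow> ('w \<Rightarrow> 'x::real_normed_vector \<Rightarrow>\<^sub>L 'k::real_normed_vector) \<Rightarrow> real \<Rightarrow> bool" where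
  "lower_pg_bound M p \<Lambda> A \<longleftrightarrow>
     0 < A \<and> (\<forall>x. ennreal (A * norm x) \<le> eLp_norm M p (\<lambda>\<omega>. blinfun_apply (\<Lambda> \<omega>) x))"

definition upper_pg_bound ::
  "'w measure \<Rightarrow> real \<Rightarrow> ('w \<Rightarrow> 'x::real_normed_vector \<Rightarrow>\<^sub>L 'k::real_normed_vector) \<Rightarrow> real \<Rightarrow> bool" where
  "upper_pg_bound M p \<Lambda> B \<longleftrightarrow>
     0 < B \<and> (\<forall>x. eLp_norm M p (\<lambda>\<omega>. blinfun_apply (\<Lambda> \<omega>) x) \<le> ennreal (B * norm x))"

definition optimal_lower_pg_bound ::
  "'w measure \<Rightarrow> real \<Rightarrow> ('w \<Rightarrow> 'x::real_normed_vector \<Rightarrow>\<^sub>L 'k::real_normed_vector) \<Rightarrow> real \<Rightarrow> bool" where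
  "optimal_lower_pg_bound M p \<Lambda> A \<longleftrightarrow>
     lower_pg_bound M p \<Lambda> A \<and> (\<forall>A'. lower_pg_bound M p \<Lambda> A' \<longrightarrow> A' \<le> A)"

definition optimal_upper_pg_bound ::
  "'w measure \<Rightarrow> real \<Rightarrow> ('w \<Rightarrow> 'x::real_normed_vector \<Rightarrow>\<^sub>L 'k::real_normed_vector) \<Rightarrow> real \<Rightarrow> bool" where
  "optimal_upper_pg_bound M p \<Lambda> B \<longleftrightarrow>
     upper_pg_bound M p \<Lambda> B \<and> (\<forall>B'. upper_pg_bound M p \<Lambda> B' \<longrightarrow> B \<le> B')"

definition bochner_pg_frame ::
  "'w measure \<Rightarrow> ('f \<Rightarrow> 'x::real_normed_vector \<Rightarrow> 'x) \<Rightarrow> ('f \<Rightarrow> 'k::real_normed_vector \<Rightarrow> 'k) \<Rightarrow>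
   ('w \<Rightarrow> 'k set) \<Rightarrow> real \<Rightarrow> ('w \<Rightarrow> 'x \<Rightarrow>\<^sub>L 'k) \<Rightarrow> bool" where
  "bochner_pg_frame M sX sK H p \<Lambda> \<longleftrightarrow>
     (\<forall>\<omega>\<in>space M. \<Lambda> \<omega> \<in> bounded_ops sX sK \<and> range (blinfun_apply (\<Lambda> \<omega>)) \<subseteq> H \<omega>) \<and>
     (\<forall>x. bochner_measurable M (\<lambda>\<omega>. blinfun_apply (\<Lambda> \<omega>) x)) \<and>
     (\<exists>A B. lower_pg_bound M p \<Lambda> A \<and> upper_pg_bound M p \<Lambda> B)"

definition analysis_op ::
  "'w measure \<Rightarrow> ('w \<Rightarrow> 'x::real_normed_vector \<Rightarrow>\<^sub>L 'k::real_normed_vector) \<Rightarrow> 'x \<Rightarrow> ('w \<Rightarrow> 'k) set" where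
  "analysis_op M \<Lambda> x = ae_class M (\<lambda>\<omega>. blinfun_apply (\<Lambda> \<omega>) x)"

text \<open>
  The pairing \<open>\<langle>u, v\<rangle> = \<nu>(v)(u)\<close> is integrated over the completion of the measure, since the
  integrand is in general only almost everywhere equal to a measurable function and the Bochner
  integral of a non-measurable function is 0 by convention.
\<close>

definition synthesis_op ::
  "'w measure \<Rightarrow> ('k::real_normed_vector \<Rightarrow> 'k \<Rightarrow>\<^sub>L 'f::euclidean_space) \<Rightarrow>
   ('w \<Rightarrow> 'x::real_normed_vector \<Rightarrow>\<^sub>L 'k) \<Rightarrow> ('w \<Rightarrow> 'k) set \<Rightarrow> ('x \<Rightarrow>\<^sub>L 'f)" where
  "synthesis_op M \<nu> \<Lambda> C =
     Blinfun (\<lambda>x. \<integral>\<omega>. blinfun_apply (\<nu> (rep C \<omega>)) (blinfun_apply (\<Lambda> \<omega>) x) \<partial>completion M)"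

end

theory Submission
  imports Defs
begin

text \<open>
  Write \<open>\<parallel>U x\<parallel>\<close> for the \<open>p\<close>-norm of \<open>\<lambda>\<omega>. \<Lambda> \<omega> x\<close>. Both claims express that the best constant in an
  inequality between norms is an operator norm.

  For the upper bound, the inequality \<open>\<parallel>U x\<parallel> \<le> B \<parallel>x\<parallel>\<close> and Hoelder's inequality give
  \<open>\<parallel>T G\<parallel> \<le> B\<close> for all \<open>G\<close> in the unit ball of the \<open>q\<close>-space (\<open>synthesis_op_bounded\<close>). In the other
  direction \<open>\<parallel>U x\<parallel>\<close> has to be attained as a value of the pairing of \<open>U x\<close> with an element of
  that ball. In a Hilbert space this element can be written down: if \<open>J u\<close> is the vector that \<open>\<nu>\<close>
  sends to the functional \<open>\<lambda>w. ip w u\<close>, it is a normalisation of \<open>\<parallel>F\<parallel>\<^bsup>p-2\<^esup> J F\<close> with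
  \<open>F \<omega> = \<Lambda> \<omega> x\<close> (\<open>norming_function\<close>). Only the construction of \<open>J\<close> uses the inner product, through
  the Cauchy--Schwarz inequality.

  For the lower bound, \<open>A \<parallel>x\<parallel> \<le> \<parallel>U x\<parallel>\<close> makes \<open>U\<close> injective and says that its inverse has norm at
  most \<open>1 / A\<close>; rescaling \<open>x\<close> to \<open>\<parallel>U x\<parallel> = 1\<close> gives the converse.
\<close>

section \<open>Bochner measurable functions\<close>

text \<open>
  The preimages under \<open>f\<close> and \<open>g\<close> differ by subsets of a null set, which the completion contains.
\<close>

lemma measurable_completion_AE_eq:
  assumes g: "g \<in> measurable M N" and f: "f \<in> space M \<rightarrow> space N"
    and ae: "AE \<omega> in M. f \<omega> = g \<omega>"
  shows "f \<in> measurable (completion M) N"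
proof (rule measurableI)
  show "\<And>x. x \<in> space (completion M) \<Longrightarrow> f x \<in> space N" using f by auto
next
  fix S assume S: "S \<in> sets N"
  have [measurable]: "Measurable.pred (completion M) (\<lambda>\<omega>. g \<omega> \<in> S)"
    using measurable_completion[OF g] S by measurable
  have [measurable]: "Measurable.pred (completion M) (\<lambda>\<omega>. f \<omega> \<in> S \<and> g \<omega> \<notin> S)"
    using ae by (intro sets_completion_AE) auto
  have [measurable]: "Measurable.pred (completion M) (\<lambda>\<omega>. f \<omega> \<notin> S \<and> g \<omega> \<in> S)"
    using ae by (intro sets_completion_AE) auto
  have "f -` S \<inter> space (completion M) =
      {\<omega> \<in> space (completion M). (g \<omega> \<in> S \<or> (f \<omega> \<in> S \<and> g \<omega> \<notin> S)) \<and>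
         \<not> (f \<omega> \<notin> S \<and> g \<omega> \<in> S)}"
    by auto
  also have "\<dots> \<in> sets (completion M)" by measurable
  finally show "f -` S \<inter> space (completion M) \<in> sets (completion M)" .
qed

lemma simple_function_borel:
  "simple_function M f \<Longrightarrow> f \<in> borel_measurable M"
  using measurable_compose[OF measurable_simple_function measurable_count_space_eq1[THEN iffD2], of M f "\<lambda>x. x" borel]
  by auto

text \<open>
  A pointwise limit of measurable maps into a metric space is Borel measurable even when the target
  is not separable. Convergence may fail on a null set, so the limit is measurable only
  with respect to the completion. This lets the additivity and homogeneity of the nonnegative
  integral be applied over the completion, which has the same nonnegative integral as \<open>M\<close>.
\<close>

lemma bochner_measurable_borel_completion:
  fixes f :: "'w \<Rightarrow> 'b::real_normed_vector"
  assumes "bochner_measurable M f"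
  shows "f \<in> borel_measurable (completion M)"
proof -
  obtain s where s: "\<And>n. simple_function M (s n)"
    and ae: "AE \<omega> in M. (\<lambda>n::nat. norm (s n \<omega> - f \<omega>)) \<longlonglongrightarrow> 0"
    using assms by (auto simp: bochner_measurable_def)
  obtain N where N: "N \<in> null_sets M"
    and sub: "{\<omega> \<in> space M. \<not> (\<lambda>n::nat. norm (s n \<omega> - f \<omega>)) \<longlonglongrightarrow> 0} \<subseteq> N"
    using ae by (auto simp: eventually_ae_filter)
  \<comment> \<open>Replacing everything by 0 on \<open>N\<close> turns the convergence into one at every point.\<close>
  define g where "g \<omega> = (if \<omega> \<in> N then 0 else f \<omega>)" for \<omega>
  have "g \<in> borel_measurable M"
  proof (rule borel_measurable_LIMSEQ_metric)
    show "(\<lambda>\<omega>. if \<omega> \<in> N then 0 else s n \<omega>) \<in> borel_measurable M" for n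
      using N simple_function_borel[OF s[of n]] by (intro measurable_If_set) auto
  next
    fix \<omega> assume "\<omega> \<in> space M"
    then show "(\<lambda>n. if \<omega> \<in> N then 0 else s n \<omega>) \<longlonglongrightarrow> g \<omega>"
      using sub by (auto simp: g_def intro: LIM_zero_cancel tendsto_norm_zero_cancel)
  qed
  moreover have "AE \<omega> in M. f \<omega> = g \<omega>"
    using AE_not_in[OF N] by eventually_elim (simp add: g_def)
  ultimately show ?thesis by (intro measurable_completion_AE_eq) auto
qed

text \<open>
  The approximating simple functions can be substituted into \<open>h\<close>. Going through them is
  essential: for a non-separable target, a pair of Borel measurable maps need not be Borel
  measurable into the product, so joint continuity of \<open>h\<close> would not suffice for Borel functions.
\<close>

lemma bochner_measurable_compose2:
  assumes F: "bochner_measurable M F" and G: "bochner_measurable M G"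
    and h: "\<And>x y a b. a \<longlonglongrightarrow> x \<Longrightarrow> b \<longlonglongrightarrow> y \<Longrightarrow> (\<lambda>n::nat. h (a n) (b n)) \<longlonglongrightarrow> h x y"
  shows "bochner_measurable M (\<lambda>\<omega>. h (F \<omega>) (G \<omega>))"
proof -
  obtain s where s: "\<And>n. simple_function M (s n)"
    and ae_s: "AE \<omega> in M. (\<lambda>n::nat. norm (s n \<omega> - F \<omega>)) \<longlonglongrightarrow> 0"
    using F by (auto simp: bochner_measurable_def)
  obtain t where t: "\<And>n. simple_function M (t n)"
    and ae_t: "AE \<omega> in M. (\<lambda>n::nat. norm (t n \<omega> - G \<omega>)) \<longlonglongrightarrow> 0"
    using G by (auto simp: bochner_measurable_def)
  have "AE \<omega> in M. (\<lambda>n::nat. norm (h (s n \<omega>) (t n \<omega>) - h (F \<omega>) (G \<omega>))) \<longlonglongrightarrow> 0"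
    using ae_s ae_t
  proof eventually_elim
    case (elim \<omega>)
    have "(\<lambda>n. s n \<omega>) \<longlonglongrightarrow> F \<omega>" "(\<lambda>n. t n \<omega>) \<longlonglongrightarrow> G \<omega>"
      using elim by (auto intro: LIM_zero_cancel tendsto_norm_zero_cancel)
    from h[OF this] show ?case by (intro tendsto_norm_zero LIM_zero)
  qed
  moreover have "simple_function M (\<lambda>\<omega>. h (s n \<omega>) (t n \<omega>))" for n
    by (rule simple_function_compose2[OF s t])
  ultimately show ?thesis
    unfolding bochner_measurable_def by (intro exI[of _ "\<lambda>n \<omega>. h (s n \<omega>) (t n \<omega>)"]) auto
qed

lemma bochner_measurable_compose:
  assumes "bochner_measurable M F" and "continuous_on UNIV h"
  shows "bochner_measurable M (\<lambda>\<omega>. h (F \<omega>))"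
  using assms(2)
  by (intro bochner_measurable_compose2[OF assms(1) assms(1), where h = "\<lambda>u _. h u"])
    (auto intro: continuous_on_tendsto_compose)

section \<open>The spaces of Bochner integrable functions\<close>

lemma eLp_norm_le_iff:
  assumes "0 < r" "0 \<le> c"
  shows "eLp_norm M r F \<le> ennreal c \<longleftrightarrow> (\<integral>\<^sup>+ \<omega>. ennreal (norm (F \<omega>) powr r) \<partial>M) \<le> ennreal (c powr r)"
proof (cases "\<integral>\<^sup>+ \<omega>. ennreal (norm (F \<omega>) powr r) \<partial>M" rule: ennreal_cases)
  case (real j)
  have "j powr (1 / r) \<le> c \<longleftrightarrow> j \<le> c powr r"
    using assms real powr_mono2[of "1/r" j "c powr r"] powr_mono2[of r "j powr (1/r)" c]
    by (auto simp: powr_powr)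
  then show ?thesis using assms real by (simp add: eLp_norm_def)
next
  case top
  then show ?thesis by (simp add: eLp_norm_def top_unique)
qed

lemma eLp_norm_eqD:
  assumes "0 < r" "0 \<le> c" "eLp_norm M r F = ennreal c"
  shows "(\<integral>\<^sup>+ \<omega>. ennreal (norm (F \<omega>) powr r) \<partial>M) = ennreal (c powr r)"
proof (cases "\<integral>\<^sup>+ \<omega>. ennreal (norm (F \<omega>) powr r) \<partial>M" rule: ennreal_cases)
  case (real j)
  then show ?thesis using assms by (auto simp: eLp_norm_def powr_powr)
next
  case top
  then show ?thesis using assms by (simp add: eLp_norm_def)
qed

lemma eLp_norm_cong_AE:
  "AE \<omega> in M. F \<omega> = G \<omega> \<Longrightarrow> eLp_norm M r F = eLp_norm M r G"
proof -
  assume "AE \<omega> in M. F \<omega> = G \<omega>"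
  then have "(\<integral>\<^sup>+ \<omega>. ennreal (norm (F \<omega>) powr r) \<partial>M) = (\<integral>\<^sup>+ \<omega>. ennreal (norm (G \<omega>) powr r) \<partial>M)"
    by (intro nn_integral_cong_AE) auto
  then show ?thesis by (simp add: eLp_norm_def)
qed

lemma eLp_norm_scaleR:
  assumes F: "bochner_measurable M F" and r: "0 < r" and fin: "eLp_norm M r F < \<infinity>"
  shows "eLp_norm M r (\<lambda>\<omega>. c *\<^sub>R F \<omega>) = ennreal \<bar>c\<bar> * eLp_norm M r F"
proof -
  have [measurable]: "F \<in> borel_measurable (completion M)"
    by (rule bochner_measurable_borel_completion[OF F])
  obtain j where j: "(\<integral>\<^sup>+ \<omega>. ennreal (norm (F \<omega>) powr r) \<partial>M) = ennreal j" "0 \<le> j"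
    using fin by (cases "\<integral>\<^sup>+ \<omega>. ennreal (norm (F \<omega>) powr r) \<partial>M" rule: ennreal_cases)
      (auto simp: eLp_norm_def)
  have "(\<integral>\<^sup>+ \<omega>. ennreal (norm (c *\<^sub>R F \<omega>) powr r) \<partial>M) =
      (\<integral>\<^sup>+ \<omega>. ennreal (\<bar>c\<bar> powr r) * ennreal (norm (F \<omega>) powr r) \<partial>completion M)"
    by (simp add: nn_integral_completion powr_mult ennreal_mult)
  also have "\<dots> = ennreal (\<bar>c\<bar> powr r) * ennreal j"
    by (subst nn_integral_cmult) (auto simp: nn_integral_completion j)
  finally have "(\<integral>\<^sup>+ \<omega>. ennreal (norm (c *\<^sub>R F \<omega>) powr r) \<partial>M) = ennreal (\<bar>c\<bar> powr r * j)"
    using j by (simp add: ennreal_mult)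
  then have "eLp_norm M r (\<lambda>\<omega>. c *\<^sub>R F \<omega>) = ennreal ((\<bar>c\<bar> powr r * j) powr (1 / r))"
    using j by (simp add: eLp_norm_def del: norm_scaleR)
  also have "\<dots> = ennreal \<bar>c\<bar> * ennreal (j powr (1 / r))"
    using j r by (simp add: powr_mult powr_powr ennreal_mult)
  finally show ?thesis using j by (simp add: eLp_norm_def)
qed

lemma rep_ae_class:
  assumes "bochner_measurable M F"
  shows "bochner_measurable M (rep (ae_class M F))" "AE \<omega> in M. rep (ae_class M F) \<omega> = F \<omega>"
proof -
  have "F \<in> ae_class M F" using assms by (simp add: ae_class_def)
  then have "rep (ae_class M F) \<in> ae_class M F" unfolding rep_def by (rule someI[where P = "\<lambda>G. G \<in> ae_class M F"])
  then show "bochner_measurable M (rep (ae_class M F))" "AE \<omega> in M. rep (ae_class M F) \<omega> = F \<omega>"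
    by (auto simp: ae_class_def)
qed

lemma Lp_norm_ae_class:
  "bochner_measurable M F \<Longrightarrow> Lp_norm M r (ae_class M F) = enn2real (eLp_norm M r F)"
  unfolding Lp_norm_def using eLp_norm_cong_AE[OF rep_ae_class(2)] by metis

lemma Lp_space_rep:
  assumes "C \<in> Lp_space M r"
  shows "bochner_measurable M (rep C)" "eLp_norm M r (rep C) = ennreal (Lp_norm M r C)"
proof -
  obtain F where F: "bochner_measurable M F" "eLp_norm M r F < \<infinity>" "C = ae_class M F"
    using assms by (auto simp: Lp_space_def)
  show "bochner_measurable M (rep C)" using rep_ae_class(1)[OF F(1)] F(3) by simp
  show "eLp_norm M r (rep C) = ennreal (Lp_norm M r C)"
    using eLp_norm_cong_AE[OF rep_ae_class(2)[OF F(1)], of r] F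
    by (simp add: Lp_norm_ae_class)
qed

text \<open>
  Young's inequality, applied pointwise to \<open>\<parallel>F\<parallel> / n\<close> and \<open>\<parallel>G\<parallel> / m\<close> and integrated, bounds the
  integral by \<open>n * m * (1 / p + 1 / q)\<close>.
\<close>

lemma Holder_bochner:
  assumes pq: "1 < p" "1 / p + 1 / q = 1"
    and F: "bochner_measurable M F" and G: "bochner_measurable M G"
    and n: "0 < n" "eLp_norm M p F \<le> ennreal n" and m: "0 < m" "eLp_norm M q G \<le> ennreal m"
  shows "(\<integral>\<^sup>+ \<omega>. ennreal (norm (F \<omega>) * norm (G \<omega>)) \<partial>M) \<le> ennreal (n * m)"
proof -
  have "1 / q = 1 - 1 / p" using pq by simp
  also have "\<dots> > 0" using pq by simp
  finally have q: "0 < q" by simp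
  have "1 / q < 1" using pq \<open>1 / q = 1 - 1 / p\<close> by simp
  then have q1: "1 < q" using q by simp
  have [measurable]: "F \<in> borel_measurable (completion M)" "G \<in> borel_measurable (completion M)"
    using F G by (auto intro: bochner_measurable_borel_completion)
  have young: "a * b \<le> n * m * (a powr p / (p * n powr p) + b powr q / (q * m powr q))"
    if "0 \<le> a" "0 \<le> b" for a b
  proof -
    have "(a / n) * (b / m) \<le> (a / n) powr p / p + (b / m) powr q / q"
      using that n m pq q1 by (intro Youngs_inequality) auto
    also have "\<dots> = a powr p / (p * n powr p) + b powr q / (q * m powr q)"
      using that n m by (simp add: powr_divide mult.commute)
    finally have "n * m * ((a / n) * (b / m)) \<le> n * m * (a powr p / (p * n powr p) + b powr q / (q * m powr q))"
      using n m by (intro mult_left_mono) auto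
    then show ?thesis using n m by simp
  qed
  have "(\<integral>\<^sup>+ \<omega>. ennreal (norm (F \<omega>) * norm (G \<omega>)) \<partial>M) \<le>
     (\<integral>\<^sup>+ \<omega>. ennreal (n * m / (p * n powr p)) * ennreal (norm (F \<omega>) powr p)
         + ennreal (n * m / (q * m powr q)) * ennreal (norm (G \<omega>) powr q) \<partial>completion M)"
    unfolding nn_integral_completion
  proof (rule nn_integral_mono)
    fix \<omega>
    have "norm (F \<omega>) * norm (G \<omega>) \<le> n * m / (p * n powr p) * norm (F \<omega>) powr p
        + n * m / (q * m powr q) * norm (G \<omega>) powr q"
      using young[of "norm (F \<omega>)" "norm (G \<omega>)"] by (simp add: algebra_simps)
    then show "ennreal (norm (F \<omega>) * norm (G \<omega>)) \<le>
        ennreal (n * m / (p * n powr p)) * ennreal (norm (F \<omega>) powr p)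
        + ennreal (n * m / (q * m powr q)) * ennreal (norm (G \<omega>) powr q)"
      using n m pq q
      by (simp add: ennreal_mult[symmetric] ennreal_plus[symmetric] ennreal_leI del: ennreal_plus)
  qed
  also have "\<dots> = ennreal (n * m / (p * n powr p)) * (\<integral>\<^sup>+ \<omega>. ennreal (norm (F \<omega>) powr p) \<partial>M)
         + ennreal (n * m / (q * m powr q)) * (\<integral>\<^sup>+ \<omega>. ennreal (norm (G \<omega>) powr q) \<partial>M)"
    by (simp add: nn_integral_add nn_integral_cmult) (simp add: nn_integral_completion)
  also have "\<dots> \<le> ennreal (n * m / (p * n powr p)) * ennreal (n powr p)
         + ennreal (n * m / (q * m powr q)) * ennreal (m powr q)"
    using n m pq q by (intro add_mono mult_left_mono) (auto simp: eLp_norm_le_iff)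
  also have "\<dots> = ennreal (n * m / p + n * m / q)"
    using n m pq q by (simp add: ennreal_mult[symmetric] ennreal_plus[symmetric] del: ennreal_plus)
  also have "n * m / p + n * m / q = n * m * (1 / p + 1 / q)" by (simp add: algebra_simps)
  finally show ?thesis using pq by simp
qed

section \<open>Duality in a Hilbert space\<close>

lemma (in hilbert_space_over) ip_diff_right: "ip w (u - v) = ip w u - ip w v"
proof -
  have "ip ((u - v) + v) w = ip (u - v) w + ip v w" by (rule ip_add_left)
  then have "ip (u - v) w = ip u w - ip v w" by simp
  moreover have "scalar_cnj (a - b) = scalar_cnj a - scalar_cnj b" for a b
    by (simp add: scalar_cnj_def inner_diff_left of_real_diff algebra_simps)
  ultimately show ?thesis by (simp only: ip_cnj[of w])
qed

text \<open>
  The first half of the Cauchy--Schwarz inequality: \<open>ip w u \<bullet> 1\<close> is the real part of the inner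
  product and a real symmetric bilinear form, so the usual argument with the square of
  \<open>\<parallel>u\<parallel> w - \<parallel>w\<parallel> u\<close> applies.
\<close>

lemma (in hilbert_space_over) Re_ip_le: "ip w u \<bullet> 1 \<le> norm w * norm u"
proof -
  define R where "R a b = ip a b \<bullet> 1" for a b
  have R_self: "R a a = (norm a)\<^sup>2" for a
    by (simp add: R_def ip_self of_real_def norm_eq_1[symmetric])
  have cnj1: "scalar_cnj z \<bullet> 1 = z \<bullet> 1" for z
    by (simp add: scalar_cnj_def of_real_def inner_diff_left norm_eq_1[symmetric])
  have R_sym: "R b a = R a b" for a b unfolding R_def by (subst ip_cnj) (rule cnj1)
  have R_add: "R (a + b) c = R a c + R b c" for a b c
    by (simp add: R_def ip_add_left inner_add_left)
  have R_scale: "R (r *\<^sub>R a) c = r * R a c" for r a c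
    unfolding R_def scale_of_real[symmetric] ip_scale_left
    by (simp add: scaleR_conv_of_real[symmetric])
  have R_add': "R c (a + b) = R c a + R c b" for a b c
    using R_add R_sym by metis
  have R_scale': "R c (r *\<^sub>R a) = r * R c a" for r a c
    using R_scale R_sym by metis
  let ?w = "norm u *\<^sub>R w" and ?u = "norm w *\<^sub>R u"
  have "0 \<le> R (?w + (- 1) *\<^sub>R ?u) (?w + (- 1) *\<^sub>R ?u)" unfolding R_self by simp
  also have "\<dots> = (norm u)\<^sup>2 * R w w - 2 * (norm w * norm u) * R w u + (norm w)\<^sup>2 * R u u"
    unfolding R_add R_add' R_scale R_scale' R_sym[of u w]
    by (simp add: power2_eq_square algebra_simps)
  also have "\<dots> = 2 * (norm w * norm u) * (norm w * norm u - R w u)"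
    unfolding R_self by (simp add: power2_eq_square algebra_simps)
  finally have *: "0 \<le> 2 * (norm w * norm u) * (norm w * norm u - R w u)" .
  show ?thesis
  proof (cases "w = 0 \<or> u = 0")
    case True
    then have "R w u = 0"
      using R_scale[of 0 0 u] R_scale'[of w 0 0] by auto
    then show ?thesis by (simp add: R_def)
  next
    case False
    then have "0 < 2 * (norm w * norm u)" by simp
    with * have "0 \<le> norm w * norm u - R w u" by (metis zero_le_mult_iff not_le)
    then show ?thesis by (simp add: R_def)
  qed
qed

text \<open>
  Multiplying \<open>w\<close> by a scalar of norm 1 makes the inner product real and nonnegative, which
  reduces the claim to real parts. This uses only division in the field of scalars, and so covers
  real and complex scalars at once.
\<close>

lemma (in hilbert_space_over) norm_ip_le: "norm (ip w u) \<le> norm w * norm u"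
proof (cases "ip w u = 0")
  case False
  define a where "a = of_real (norm (ip w u)) / ip w u"
  have a: "norm a = 1" "a * ip w u = of_real (norm (ip w u))"
    using False by (auto simp: a_def norm_divide)
  have "norm (ip w u) = ip (scale a w) u \<bullet> 1"
    by (simp add: ip_scale_left a of_real_def norm_eq_1[symmetric])
  also have "\<dots> \<le> norm w * norm u" using Re_ip_le[of "scale a w" u] by (simp add: norm_scale a)
  finally show ?thesis .
qed simp

lemma dual_isometry_dist:
  assumes "dual_isometry s \<nu>"
  shows "norm (\<nu> u - \<nu> v) = norm (u - v)"
proof -
  have "\<nu> ((u - v) + v) = \<nu> (u - v) + \<nu> v" using assms unfolding dual_isometry_def by blast
  then have "\<nu> u - \<nu> v = \<nu> (u - v)" by simp
  then show ?thesis using assms by (simp add: dual_isometry_def)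
qed

text \<open>
  The isometry \<open>\<nu>\<close> is linear, so \<open>\<nu> u\<close> is in general not the functional \<open>\<lambda>w. ip w u\<close>, which
  depends conjugate-linearly on \<open>u\<close>. As \<open>\<nu>\<close> is onto the dual, that functional equals \<open>\<nu> (J u)\<close>
  for some \<open>J u\<close>. The map \<open>J\<close> is a real-linear isometry; the estimates stated here are what
  measurability and the norm of the norming function below require.
\<close>

lemma Riesz_representative:
  fixes ip :: "'k::banach \<Rightarrow> 'k \<Rightarrow> 'f::{real_normed_field,euclidean_space}"
  assumes "hilbert_space_over s ip" and \<nu>: "dual_isometry s \<nu>"
  shows "\<exists>J. (\<forall>u. blinfun_apply (\<nu> (J u)) u = of_real ((norm u)\<^sup>2)) \<and>
    (\<forall>u v. norm (J u - J v) \<le> norm (u - v)) \<and> (\<forall>u. norm (J u) \<le> norm u)"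
proof -
  interpret hilbert_space_over s ip by fact
  have bl: "bounded_linear (\<lambda>w. ip w u)" for u
  proof (rule bounded_linear_intro)
    show "ip (r *\<^sub>R a) u = r *\<^sub>R ip a u" for r a
      by (metis ip_scale_left scale_of_real scaleR_conv_of_real)
    show "norm (ip w u) \<le> norm w * norm u" for w by (rule norm_ip_le)
  qed (rule ip_add_left)
  have app: "blinfun_apply (Blinfun (\<lambda>w. ip w u)) w = ip w u" for u w
    using bl by (simp add: bounded_linear_Blinfun_apply)
  have "Blinfun (\<lambda>w. ip w u) \<in> range \<nu>" for u
    using \<nu> unfolding dual_isometry_def dual_space_def bounded_ops_def
    by (simp add: app ip_scale_left)
  then have "\<exists>v. \<nu> v = Blinfun (\<lambda>w. ip w u)" for u
    unfolding image_iff by metis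
  then obtain J where "\<And>u. \<nu> (J u) = Blinfun (\<lambda>w. ip w u)" by metis
  then have J: "blinfun_apply (\<nu> (J u)) w = ip w u" for u w by (simp add: app)
  have lip: "norm (J u - J v) \<le> norm (u - v)" for u v
  proof -
    have "norm (\<nu> (J u) - \<nu> (J v)) \<le> norm (u - v)"
      by (intro norm_blinfun_bound)
        (auto simp: blinfun.diff_left J ip_diff_right[symmetric] norm_ip_le mult.commute)
    then show ?thesis by (simp add: dual_isometry_dist[OF \<nu>])
  qed
  have bd: "norm (J u) \<le> norm u" for u
  proof -
    have "norm (\<nu> (J u)) \<le> norm u"
      by (intro norm_blinfun_bound) (auto simp: J norm_ip_le mult.commute)
    then show ?thesis using \<nu> by (simp add: dual_isometry_def)
  qed
  have "blinfun_apply (\<nu> (J u)) u = of_real ((norm u)\<^sup>2)" for u by (simp only: J ip_self)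
  with lip bd show ?thesis by (intro exI[of _ J]) auto
qed

section \<open>The pairing of Bochner integrable functions\<close>

lemma pairing_measurable:
  fixes \<nu> :: "'k::real_normed_vector \<Rightarrow> 'k \<Rightarrow>\<^sub>L 'f::{real_normed_field,euclidean_space}"
  assumes \<nu>: "dual_isometry s \<nu>" and F: "bochner_measurable M F" and G: "bochner_measurable M G"
  shows "(\<lambda>\<omega>. blinfun_apply (\<nu> (G \<omega>)) (F \<omega>)) \<in> borel_measurable (completion M)"
proof (rule bochner_measurable_borel_completion,
    rule bochner_measurable_compose2[OF G F, where h = "\<lambda>v u. blinfun_apply (\<nu> v) u"])
  fix v u :: 'k and a b :: "nat \<Rightarrow> 'k"
  assume a: "a \<longlonglongrightarrow> v" and b: "b \<longlonglongrightarrow> u"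
  have "(\<lambda>n. \<nu> (a n)) \<longlonglongrightarrow> \<nu> v"
    using a by (simp add: tendsto_iff dist_norm dual_isometry_dist[OF \<nu>])
  then show "(\<lambda>n. blinfun_apply (\<nu> (a n)) (b n)) \<longlonglongrightarrow> blinfun_apply (\<nu> v) u"
    using b by (intro tendsto_intros)
qed

lemma pairing_bound:
  fixes \<nu> :: "'k::real_normed_vector \<Rightarrow> 'k \<Rightarrow>\<^sub>L 'f::{real_normed_field,euclidean_space}"
  assumes \<nu>: "dual_isometry s \<nu>" and pq: "1 < p" "1 / p + 1 / q = 1"
    and F: "bochner_measurable M F" and G: "bochner_measurable M G"
    and n: "0 < n" "eLp_norm M p F \<le> ennreal n" and m: "0 < m" "eLp_norm M q G \<le> ennreal m"
  shows "integrable (completion M) (\<lambda>\<omega>. blinfun_apply (\<nu> (G \<omega>)) (F \<omega>))"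
    and "norm (\<integral>\<omega>. blinfun_apply (\<nu> (G \<omega>)) (F \<omega>) \<partial>completion M) \<le> n * m"
proof -
  have "(\<integral>\<^sup>+ \<omega>. ennreal (norm (blinfun_apply (\<nu> (G \<omega>)) (F \<omega>))) \<partial>completion M) \<le>
      (\<integral>\<^sup>+ \<omega>. ennreal (norm (F \<omega>) * norm (G \<omega>)) \<partial>M)"
    unfolding nn_integral_completion
  proof (intro nn_integral_mono ennreal_leI)
    fix \<omega>
    have "norm (\<nu> (G \<omega>)) = norm (G \<omega>)" using \<nu> by (simp add: dual_isometry_def)
    then show "norm (blinfun_apply (\<nu> (G \<omega>)) (F \<omega>)) \<le> norm (F \<omega>) * norm (G \<omega>)"
      using norm_blinfun[of "\<nu> (G \<omega>)" "F \<omega>"] by (simp add: mult.commute)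
  qed
  also have "\<dots> \<le> ennreal (n * m)" by (rule Holder_bochner[OF pq F G n m])
  finally have *: "(\<integral>\<^sup>+ \<omega>. ennreal (norm (blinfun_apply (\<nu> (G \<omega>)) (F \<omega>))) \<partial>completion M) \<le> ennreal (n * m)" .
  show int: "integrable (completion M) (\<lambda>\<omega>. blinfun_apply (\<nu> (G \<omega>)) (F \<omega>))"
    unfolding integrable_iff_bounded
    using pairing_measurable[OF \<nu> F G] * by (auto intro: le_less_trans)
  show "norm (\<integral>\<omega>. blinfun_apply (\<nu> (G \<omega>)) (F \<omega>) \<partial>completion M) \<le> n * m"
    using order_trans[OF integral_norm_bound_ennreal[OF int] *] n m
    by (simp add: ennreal_le_iff)
qed

text \<open>
  The extremal case of Hoelder's inequality: \<open>G = n\<^bsup>1-p\<^esup> \<parallel>F\<parallel>\<^bsup>p-2\<^esup> J F\<close>, where \<open>n\<close> is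
  the \<open>p\<close>-norm of \<open>F\<close> and \<open>J\<close> is the map of the previous section. Since \<open>(p - 1) q = p\<close>, the function \<open>\<parallel>G\<parallel>\<^bsup>q\<^esup>\<close> is at most \<open>n\<^bsup>-p\<^esup> \<parallel>F\<parallel>\<^bsup>p\<^esup>\<close>, whose integral is 1,
  and the pairing of \<open>F\<close> with \<open>G\<close> is \<open>n\<^bsup>1-p\<^esup> \<parallel>F\<parallel>\<^bsup>p\<^esup>\<close>, whose integral is \<open>n\<close>. The explicit formula
  through a continuous map of \<open>K\<close> makes \<open>G\<close> Bochner measurable on an arbitrary measure space,
  with no appeal to a duality theorem for Bochner spaces.
\<close>

lemma norming_function:
  fixes \<nu> :: "'k::banach \<Rightarrow> 'k \<Rightarrow>\<^sub>L 'f::{real_normed_field,euclidean_space}"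
  assumes hil: "hilbert_space_over s ip" and \<nu>: "dual_isometry s \<nu>"
    and pq: "1 < p" "1 / p + 1 / q = 1"
    and F: "bochner_measurable M F" and n: "0 < n" "eLp_norm M p F = ennreal n"
  obtains G where "bochner_measurable M G" "eLp_norm M q G \<le> 1"
    "(\<integral>\<omega>. blinfun_apply (\<nu> (G \<omega>)) (F \<omega>) \<partial>completion M) = of_real n"
proof -
  obtain J where J: "\<And>u. blinfun_apply (\<nu> (J u)) u = of_real ((norm u)\<^sup>2)"
    "\<And>u v. norm (J u - J v) \<le> norm (u - v)" "\<And>u. norm (J u) \<le> norm u"
    using Riesz_representative[OF hil \<nu>] by auto
  have "1 / q = 1 - 1 / p" using pq by simp
  also have "\<dots> > 0" using pq by simp
  finally have q: "0 < q" by simp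
  have pq': "(p - 1) * q = p" using pq q by (simp add: field_simps)
  define \<Phi> where "\<Phi> u = norm u powr (p - 2) *\<^sub>R J u" for u
  have norm_\<Phi>: "norm (\<Phi> u) \<le> norm u powr (p - 1)" for u
  proof -
    have "norm (\<Phi> u) \<le> norm u powr (p - 2) * norm u" using J(3) by (simp add: \<Phi>_def mult_left_mono)
    also have "\<dots> = norm u powr (p - 1)"
      using powr_add[of "norm u" "p - 2" 1] by simp
    finally show ?thesis .
  qed
  have contJ: "continuous_on UNIV J"
    using J(2) by (auto intro!: lipschitz_on_continuous_on[of 1] simp: lipschitz_on_def dist_norm)
  have cont: "continuous_on UNIV \<Phi>"
    unfolding continuous_on_eq_continuous_at[OF open_UNIV]
  proof
    fix u :: 'k
    show "isCont \<Phi> u"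
    proof (cases "u = 0")
      case True
      \<comment> \<open>For \<open>p < 2\<close> the factor \<open>\<parallel>u\<parallel>\<^bsup>p-2\<^esup>\<close> blows up at 0, but the product still tends to 0.\<close>
      have "((\<lambda>u::'k. norm u powr (p - 1)) \<longlongrightarrow> 0) (at 0)"
        using pq by (auto intro!: tendsto_eq_intros)
      then have "(\<Phi> \<longlongrightarrow> 0) (at 0)"
        by (rule Lim_null_comparison[rotated]) (simp add: norm_\<Phi>)
      moreover have "\<Phi> 0 = 0" by (simp add: \<Phi>_def)
      ultimately show ?thesis using True by (simp add: isCont_def)
    next
      case False
      have "J \<midarrow>u\<rightarrow> J u" using contJ by (simp add: continuous_on_eq_continuous_at isCont_def)
      with False show ?thesis
        unfolding \<Phi>_def isCont_def
        by (intro tendsto_scaleR tendsto_powr tendsto_norm tendsto_const tendsto_ident_at) auto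
    qed
  qed
  define G where "G \<omega> = n powr (1 - p) *\<^sub>R \<Phi> (F \<omega>)" for \<omega>
  have G: "bochner_measurable M G"
    unfolding G_def using cont by (intro bochner_measurable_compose[OF F] continuous_intros)
  have [measurable]: "F \<in> borel_measurable (completion M)"
    by (rule bochner_measurable_borel_completion[OF F])
  have IF: "(\<integral>\<^sup>+ \<omega>. ennreal (norm (F \<omega>) powr p) \<partial>M) = ennreal (n powr p)"
    using n pq by (intro eLp_norm_eqD) auto
  have "(\<integral>\<^sup>+ \<omega>. ennreal (norm (G \<omega>) powr q) \<partial>M) \<le>
      (\<integral>\<^sup>+ \<omega>. ennreal (n powr - p) * ennreal (norm (F \<omega>) powr p) \<partial>completion M)"
    unfolding nn_integral_completion
  proof (intro nn_integral_mono)
    fix \<omega>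
    have "norm (G \<omega>) powr q \<le> (n powr (1 - p) * norm (F \<omega>) powr (p - 1)) powr q"
      using q norm_\<Phi>[of "F \<omega>"] by (intro powr_mono2) (auto simp: G_def intro!: mult_left_mono)
    also have "\<dots> = n powr ((1 - p) * q) * norm (F \<omega>) powr ((p - 1) * q)"
      by (simp add: powr_mult powr_powr)
    also have "(1 - p) * q = - p" using pq' by (simp add: algebra_simps)
    finally show "ennreal (norm (G \<omega>) powr q) \<le> ennreal (n powr - p) * ennreal (norm (F \<omega>) powr p)"
      unfolding pq' by (simp add: ennreal_mult[symmetric] ennreal_leI)
  qed
  also have "\<dots> = ennreal (n powr - p) * ennreal (n powr p)"
    by (subst nn_integral_cmult) (auto simp: nn_integral_completion IF)
  also have "\<dots> = ennreal (1 powr q)"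
    using n by (simp add: ennreal_mult[symmetric] powr_add[symmetric])
  finally have normG: "eLp_norm M q G \<le> 1"
    using eLp_norm_le_iff[OF q, of 1 M G] by simp
  have pair: "blinfun_apply (\<nu> (G \<omega>)) (F \<omega>) = of_real (n powr (1 - p) * norm (F \<omega>) powr p)" for \<omega>
  proof -
    have sc: "\<nu> (r *\<^sub>R v) = r *\<^sub>R \<nu> v" for r v
    proof (rule blinfun_eqI)
      fix w
      interpret hilbert_space_over s ip by fact
      have "blinfun_apply (\<nu> (s (of_real r) v)) w = of_real r * blinfun_apply (\<nu> v) w"
        using \<nu> unfolding dual_isometry_def by blast
      then show "blinfun_apply (\<nu> (r *\<^sub>R v)) w = blinfun_apply (r *\<^sub>R \<nu> v) w"
        by (simp add: scale_of_real blinfun.scaleR_left scaleR_conv_of_real)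
    qed
    have pow: "norm (F \<omega>) powr (p - 2) * (norm (F \<omega>))\<^sup>2 = norm (F \<omega>) powr p"
      using powr_add[of "norm (F \<omega>)" "p - 2" 2] by (cases "F \<omega> = 0") auto
    have "blinfun_apply (\<nu> (G \<omega>)) (F \<omega>) =
        of_real (n powr (1 - p) * (norm (F \<omega>) powr (p - 2) * (norm (F \<omega>))\<^sup>2))"
      by (simp add: G_def \<Phi>_def sc blinfun.scaleR_left J(1) scaleR_conv_of_real mult.assoc)
    then show ?thesis by (simp only: pow)
  qed
  have "has_bochner_integral (completion M) (\<lambda>\<omega>. norm (F \<omega>) powr p) (n powr p)"
    by (rule has_bochner_integral_nn_integral) (auto simp: nn_integral_completion IF)
  then have "has_bochner_integral (completion M)
      (\<lambda>\<omega>. of_real (n powr (1 - p) * norm (F \<omega>) powr p) :: 'f) (of_real (n powr (1 - p) * n powr p))"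
    by (intro has_bochner_integral_bounded_linear[OF bounded_linear_of_real]
        has_bochner_integral_mult_right)
  then have "(\<integral>\<omega>. blinfun_apply (\<nu> (G \<omega>)) (F \<omega>) \<partial>completion M) = of_real (n powr (1 - p) * n powr p)"
    unfolding pair by (rule has_bochner_integral_integral_eq)
  also have "n powr (1 - p) * n powr p = n"
    using n by (simp add: powr_add[symmetric])
  finally show ?thesis by (rule that[OF G normG])
qed

section \<open>The synthesis and the analysis operator\<close>

text \<open>
  The map given by the integral must be shown to be bounded and linear before its formula can be
  read off from \<open>Blinfun\<close>; Hoelder's inequality gives both integrability and the bound.
\<close>

lemma synthesis_op_bounded:
  fixes \<Lambda> :: "'w \<Rightarrow> 'x::real_normed_vector \<Rightarrow>\<^sub>L 'k::real_normed_vector"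
    and \<nu> :: "'k \<Rightarrow> 'k \<Rightarrow>\<^sub>L 'f::{real_normed_field,euclidean_space}"
  assumes \<nu>: "dual_isometry s \<nu>" and pq: "1 < p" "1 / p + 1 / q = 1"
    and \<Lambda>: "\<And>x. bochner_measurable M (\<lambda>\<omega>. blinfun_apply (\<Lambda> \<omega>) x)"
    and B: "upper_pg_bound M p \<Lambda> B"
    and C: "C \<in> Lp_space M q" and m: "0 < m" "Lp_norm M q C \<le> m"
  shows "blinfun_apply (synthesis_op M \<nu> \<Lambda> C) x =
      (\<integral>\<omega>. blinfun_apply (\<nu> (rep C \<omega>)) (blinfun_apply (\<Lambda> \<omega>) x) \<partial>completion M)"
    and "norm (synthesis_op M \<nu> \<Lambda> C) \<le> B * m"
proof -
  define T where "T x = (\<integral>\<omega>. blinfun_apply (\<nu> (rep C \<omega>)) (blinfun_apply (\<Lambda> \<omega>) x) \<partial>completion M)" for x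
  have G: "bochner_measurable M (rep C)" "eLp_norm M q (rep C) \<le> ennreal m"
    using Lp_space_rep[OF C] m by (auto simp: ennreal_leI)
  have B0: "0 < B" using B by (simp add: upper_pg_bound_def)
  have Bx: "eLp_norm M p (\<lambda>\<omega>. blinfun_apply (\<Lambda> \<omega>) x) \<le> ennreal (B * norm x)" for x
    using B by (simp add: upper_pg_bound_def)
  have int: "integrable (completion M) (\<lambda>\<omega>. blinfun_apply (\<nu> (rep C \<omega>)) (blinfun_apply (\<Lambda> \<omega>) x))"
    and bd: "norm (T x) \<le> norm x * (B * m)" for x
  proof (atomize (full), cases "x = 0")
    case False
    then have "0 < B * norm x" using B0 by simp
    from pairing_bound[OF \<nu> pq \<Lambda> G(1) this Bx m(1) G(2)]
    show "integrable (completion M) (\<lambda>\<omega>. blinfun_apply (\<nu> (rep C \<omega>)) (blinfun_apply (\<Lambda> \<omega>) x)) \<and>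
        norm (T x) \<le> norm x * (B * m)"
      by (simp add: T_def mult_ac)
  qed (simp add: T_def)
  have "bounded_linear T"
  proof (rule bounded_linear_intro)
    show "T (x + y) = T x + T y" for x y
      using int by (simp add: T_def blinfun.add_right)
    show "T (r *\<^sub>R x) = r *\<^sub>R T x" for r x
      by (simp add: T_def blinfun.scaleR_right)
  qed (rule bd)
  then have "blinfun_apply (Blinfun T) = T" by (rule bounded_linear_Blinfun_apply)
  moreover have "synthesis_op M \<nu> \<Lambda> C = Blinfun T" by (simp only: synthesis_op_def T_def[abs_def])
  ultimately have T: "blinfun_apply (synthesis_op M \<nu> \<Lambda> C) = T" by simp
  then show "blinfun_apply (synthesis_op M \<nu> \<Lambda> C) x =
      (\<integral>\<omega>. blinfun_apply (\<nu> (rep C \<omega>)) (blinfun_apply (\<Lambda> \<omega>) x) \<partial>completion M)"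
    by (simp add: T_def)
  show "norm (synthesis_op M \<nu> \<Lambda> C) \<le> B * m"
    using B0 m bd by (intro norm_blinfun_bound) (auto simp: T mult.commute)
qed

text \<open>
  By Hoelder's inequality every upper frame bound dominates the operator norm of the synthesis
  operator. Conversely, evaluating this operator at the norming function of
  \<open>\<lambda>\<omega>. \<Lambda> \<omega> x\<close> recovers the norm of that function, so the operator norm is itself an upper bound.
  The lower frame bound and a nonzero vector make it positive.
\<close>

lemma optimal_upper_bound_synthesis:
  fixes \<Lambda> :: "'w \<Rightarrow> 'x::real_normed_vector \<Rightarrow>\<^sub>L 'k::banach"
    and \<nu> :: "'k \<Rightarrow> 'k \<Rightarrow>\<^sub>L 'f::{real_normed_field,euclidean_space}"
  assumes hil: "hilbert_space_over s ip" and \<nu>: "dual_isometry s \<nu>"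
    and pq: "1 < p" "1 / p + 1 / q = 1" and nontriv: "\<exists>x::'x. x \<noteq> 0"
    and \<Lambda>: "\<And>x. bochner_measurable M (\<lambda>\<omega>. blinfun_apply (\<Lambda> \<omega>) x)"
    and A: "lower_pg_bound M p \<Lambda> A" and B: "upper_pg_bound M p \<Lambda> B"
  shows "optimal_upper_pg_bound M p \<Lambda> (op_norm (Lp_space M q) (Lp_norm M q) norm (synthesis_op M \<nu> \<Lambda>))"
proof -
  let ?T = "synthesis_op M \<nu> \<Lambda>" and ?S = "{C \<in> (Lp_space M q :: ('w \<Rightarrow> 'k) set set). Lp_norm M q C \<le> 1}"
  define \<tau> where "\<tau> = op_norm (Lp_space M q) (Lp_norm M q) norm ?T"
  have bound: "norm (?T C) \<le> B'" if "upper_pg_bound M p \<Lambda> B'" "C \<in> ?S" for B' C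
    using synthesis_op_bounded(2)[OF \<nu> pq \<Lambda> that(1), of C 1] that(2) by simp
  have unit: "ae_class M G \<in> ?S" if "bochner_measurable M G" "eLp_norm M q G \<le> 1" for G
  proof -
    have "eLp_norm M q G < \<infinity>" using that(2) by (rule le_less_trans) simp
    moreover have "Lp_norm M q (ae_class M G) \<le> 1"
      using that enn2real_mono[of "eLp_norm M q G" 1] by (simp add: Lp_norm_ae_class)
    ultimately show ?thesis using that(1) by (simp add: Lp_space_def)
  qed
  have "eLp_norm M q (\<lambda>_::'w. 0::'k) \<le> 1"
    by (simp add: eLp_norm_def)
  moreover have "bochner_measurable M (\<lambda>_::'w. 0::'k)"
    unfolding bochner_measurable_def by (intro exI[of _ "\<lambda>_ _. 0"]) auto
  ultimately have "ae_class M (\<lambda>_::'w. 0::'k) \<in> ?S" by (intro unit)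
  then have nonempty: "?S \<noteq> {}" by (metis empty_iff)
  have le: "norm (?T C) \<le> \<tau>" if "C \<in> ?S" for C
    unfolding \<tau>_def op_norm_def using that bound[OF B]
    by (intro cSUP_upper bdd_aboveI2[of _ _ B]) auto
  have key: "eLp_norm M p (\<lambda>\<omega>. blinfun_apply (\<Lambda> \<omega>) x) \<le> ennreal (\<tau> * norm x)" for x
  proof -
    obtain n where n: "eLp_norm M p (\<lambda>\<omega>. blinfun_apply (\<Lambda> \<omega>) x) = ennreal n" "0 \<le> n"
    proof
      have "eLp_norm M p (\<lambda>\<omega>. blinfun_apply (\<Lambda> \<omega>) x) \<le> ennreal (B * norm x)"
        using B by (simp add: upper_pg_bound_def)
      then have "eLp_norm M p (\<lambda>\<omega>. blinfun_apply (\<Lambda> \<omega>) x) < top"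
        by (rule le_less_trans) simp
      then show "eLp_norm M p (\<lambda>\<omega>. blinfun_apply (\<Lambda> \<omega>) x) =
          ennreal (enn2real (eLp_norm M p (\<lambda>\<omega>. blinfun_apply (\<Lambda> \<omega>) x)))"
        by simp
    qed simp
    show ?thesis
    proof (cases "n = 0")
      case False
      with n have "0 < n" by simp
      obtain G where G: "bochner_measurable M G" "eLp_norm M q G \<le> 1"
        "(\<integral>\<omega>. blinfun_apply (\<nu> (G \<omega>)) (blinfun_apply (\<Lambda> \<omega>) x) \<partial>completion M) = of_real n"
        using norming_function[OF hil \<nu> pq \<Lambda> \<open>0 < n\<close> n(1)] by metis
      let ?C = "ae_class M G"
      have C: "?C \<in> ?S" by (rule unit[OF G(1,2)])
      have "blinfun_apply (?T ?C) x =
          (\<integral>\<omega>. blinfun_apply (\<nu> (rep ?C \<omega>)) (blinfun_apply (\<Lambda> \<omega>) x) \<partial>completion M)"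
        using C by (intro synthesis_op_bounded(1)[OF \<nu> pq \<Lambda> B, where m = 1]) auto
      also have "\<dots> = (\<integral>\<omega>. blinfun_apply (\<nu> (G \<omega>)) (blinfun_apply (\<Lambda> \<omega>) x) \<partial>completion M)"
        using AE_completion[OF rep_ae_class(2)[OF G(1)]]
        by (intro integral_cong_AE pairing_measurable[OF \<nu> \<Lambda>] G rep_ae_class) auto
      finally have "n = norm (blinfun_apply (?T ?C) x)" using G(3) n by simp
      also have "\<dots> \<le> norm (?T ?C) * norm x" by (rule norm_blinfun)
      also have "\<dots> \<le> \<tau> * norm x" using le[OF C] by (rule mult_right_mono) simp
      finally show ?thesis unfolding n(1) by (rule ennreal_leI)
    qed (simp add: n)
  qed
  have "0 < \<tau>"
  proof -
    obtain x :: 'x where x: "x \<noteq> 0" using nontriv by blast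
    have "0 < A * norm x" using A x by (simp add: lower_pg_bound_def)
    moreover have "ennreal (A * norm x) \<le> ennreal (\<tau> * norm x)"
      using A by (intro order_trans[OF _ key]) (simp add: lower_pg_bound_def)
    ultimately have "0 < \<tau> * norm x"
      using ennreal_le_iff2[of "A * norm x" "\<tau> * norm x"] by auto
    then show ?thesis using x by (simp add: zero_less_mult_iff)
  qed
  then have "upper_pg_bound M p \<Lambda> \<tau>" using key by (simp add: upper_pg_bound_def)
  moreover have "\<tau> \<le> B'" if "upper_pg_bound M p \<Lambda> B'" for B'
    unfolding \<tau>_def op_norm_def using nonempty bound[OF that] by (intro cSUP_least) auto
  ultimately show ?thesis by (simp add: optimal_upper_pg_bound_def \<tau>_def[symmetric])
qed

lemma analysis_op_inj:
  fixes \<Lambda> :: "'w \<Rightarrow> 'x::real_normed_vector \<Rightarrow>\<^sub>L 'k::real_normed_vector"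
  assumes \<Lambda>: "\<And>x. bochner_measurable M (\<lambda>\<omega>. blinfun_apply (\<Lambda> \<omega>) x)"
    and A: "lower_pg_bound M p \<Lambda> A"
  shows "inj (analysis_op M \<Lambda>)"
proof (rule injI)
  fix x y :: 'x assume "analysis_op M \<Lambda> x = analysis_op M \<Lambda> y"
  then have "AE \<omega> in M. blinfun_apply (\<Lambda> \<omega>) x = blinfun_apply (\<Lambda> \<omega>) y"
    using \<Lambda>[of x] by (auto simp: analysis_op_def ae_class_def)
  then have "eLp_norm M p (\<lambda>\<omega>. blinfun_apply (\<Lambda> \<omega>) (x - y)) = eLp_norm M p (\<lambda>_. 0 :: 'k)"
    by (intro eLp_norm_cong_AE) (auto simp: blinfun.diff_right)
  also have "\<dots> = 0" by (simp add: eLp_norm_def)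
  finally have "ennreal (A * norm (x - y)) \<le> 0" using A by (metis lower_pg_bound_def)
  then have "A * norm (x - y) \<le> 0" by (simp add: ennreal_eq_0_iff)
  then show "x = y" using A by (simp add: lower_pg_bound_def mult_le_0_iff)
qed

text \<open>
  By homogeneity, \<open>A \<parallel>x\<parallel> \<le> \<parallel>U x\<parallel>\<close> for all \<open>x\<close> if and only if \<open>\<parallel>x\<parallel> \<le> 1 / A\<close> whenever
  \<open>\<parallel>U x\<parallel> \<le> 1\<close>, that is, if and only if the inverse of \<open>U\<close> has norm at most \<open>1 / A\<close>.
\<close>

lemma optimal_lower_bound_analysis:
  fixes \<Lambda> :: "'w \<Rightarrow> 'x::real_normed_vector \<Rightarrow>\<^sub>L 'k::real_normed_vector"
  assumes p: "0 < p" and nontriv: "\<exists>x::'x. x \<noteq> 0"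
    and \<Lambda>: "\<And>x. bochner_measurable M (\<lambda>\<omega>. blinfun_apply (\<Lambda> \<omega>) x)"
    and A: "lower_pg_bound M p \<Lambda> A" and B: "upper_pg_bound M p \<Lambda> B"
  shows "optimal_lower_pg_bound M p \<Lambda>
      (1 / op_norm (range (analysis_op M \<Lambda>)) (Lp_norm M p) norm (inv (analysis_op M \<Lambda>)))"
proof -
  let ?U = "analysis_op M \<Lambda>"
  define N where "N x = enn2real (eLp_norm M p (\<lambda>\<omega>. blinfun_apply (\<Lambda> \<omega>) x))" for x
  have fin: "eLp_norm M p (\<lambda>\<omega>. blinfun_apply (\<Lambda> \<omega>) x) < \<infinity>" for x
    using B unfolding upper_pg_bound_def by (metis ennreal_less_top infinity_ennreal_def le_less_trans)
  have N: "eLp_norm M p (\<lambda>\<omega>. blinfun_apply (\<Lambda> \<omega>) x) = ennreal (N x)" for x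
    using fin[of x] by (simp add: N_def)
  have N0: "0 \<le> N x" for x by (simp add: N_def)
  have normU: "Lp_norm M p (?U x) = N x" for x
    by (simp add: analysis_op_def Lp_norm_ae_class[OF \<Lambda>] N_def)
  have N_scale: "N (c *\<^sub>R x) = \<bar>c\<bar> * N x" for c x
    using eLp_norm_scaleR[OF \<Lambda> p fin, of c x]
    by (simp add: N_def blinfun.scaleR_right enn2real_mult)
  have lower_iff: "lower_pg_bound M p \<Lambda> A' \<longleftrightarrow> 0 < A' \<and> (\<forall>x. A' * norm x \<le> N x)" for A'
    unfolding lower_pg_bound_def N by (simp add: ennreal_le_iff N0)
  have Npos: "0 < N x" if "x \<noteq> 0" for x
    using A that unfolding lower_iff by (metis less_le_trans mult_pos_pos zero_less_norm_iff)
  let ?S = "{v \<in> range ?U. Lp_norm M p v \<le> 1}"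
  define \<sigma> where "\<sigma> = op_norm (range ?U) (Lp_norm M p) norm (inv ?U)"
  have inv: "inv ?U (?U x) = x" for x
    by (rule inv_f_f[OF analysis_op_inj[OF \<Lambda> A]])
  have bound: "norm (inv ?U v) \<le> 1 / A'" if A': "lower_pg_bound M p \<Lambda> A'" and v: "v \<in> ?S" for A' v
  proof -
    obtain x where x: "v = ?U x" "N x \<le> 1" using v by (auto simp: normU)
    have "A' * norm x \<le> 1" using A' x(2) unfolding lower_iff by (meson order_trans)
    then show ?thesis using A' by (simp add: x inv lower_iff field_simps)
  qed
  have le: "norm x \<le> \<sigma> * N x" if x: "x \<noteq> 0" for x
  proof -
    let ?y = "(1 / N x) *\<^sub>R x"
    have "?U ?y \<in> ?S" using Npos[OF x] N_scale[of "1 / N x" x] by (simp add: normU)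
    then have "norm (inv ?U (?U ?y)) \<le> \<sigma>"
      unfolding \<sigma>_def op_norm_def using bound[OF A]
      by (intro cSUP_upper bdd_aboveI2[of _ _ "1 / A"]) auto
    then show ?thesis using Npos[OF x] unfolding inv by (simp add: field_simps)
  qed
  obtain x0 :: 'x where x0: "x0 \<noteq> 0" using nontriv by blast
  have "0 < \<sigma> * N x0" using le[OF x0] x0 by (meson less_le_trans zero_less_norm_iff)
  then have \<sigma>: "0 < \<sigma>" using Npos[OF x0] by (simp add: zero_less_mult_iff)
  have "1 / \<sigma> * norm x \<le> N x" for x
    using le[of x] \<sigma> by (cases "x = 0") (auto simp: field_simps N0)
  then have "lower_pg_bound M p \<Lambda> (1 / \<sigma>)" using \<sigma> by (simp add: lower_iff)
  moreover have "A' \<le> 1 / \<sigma>" if A': "lower_pg_bound M p \<Lambda> A'" for A'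
  proof -
    have "?U 0 \<in> ?S" using N_scale[of 0 0] by (simp add: normU)
    then have "\<sigma> \<le> 1 / A'"
      unfolding \<sigma>_def op_norm_def using bound[OF A'] by (intro cSUP_least) auto
    then show ?thesis using A' \<sigma> by (simp add: lower_iff field_simps)
  qed
  ultimately show ?thesis by (simp add: optimal_lower_pg_bound_def \<sigma>_def[symmetric])
qed

theorem theorem2p15:
  fixes M :: "'w measure"
    and sX :: "'f::{real_normed_field,euclidean_space} \<Rightarrow> 'x::banach \<Rightarrow> 'x"
    and sK :: "'f \<Rightarrow> 'k::banach \<Rightarrow> 'k"
    and ip :: "'k \<Rightarrow> 'k \<Rightarrow> 'f"
    and H :: "'w \<Rightarrow> 'k set"
    and \<nu> :: "'k \<Rightarrow> 'k \<Rightarrow>\<^sub>L 'f"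
    and \<Lambda> :: "'w \<Rightarrow> 'x \<Rightarrow>\<^sub>L 'k"
    and p q :: real
  assumes "1 < p" and "1 / p + 1 / q = 1"
    and "normed_space_over sX" and "\<exists>x::'x. x \<noteq> 0"
    and "hilbert_direct_sum sK ip (space M) H"
    and "dual_isometry sK \<nu>"
    and "bochner_pg_frame M sX sK H p \<Lambda>"
  shows "optimal_upper_pg_bound M p \<Lambda>
           (op_norm (Lp_space M q) (Lp_norm M q) norm (synthesis_op M \<nu> \<Lambda>))
       \<and> optimal_lower_pg_bound M p \<Lambda>
           (1 / op_norm (range (analysis_op M \<Lambda>)) (Lp_norm M p) norm (inv (analysis_op M \<Lambda>)))"
proof -
  have hil: "hilbert_space_over sK ip"
    using assms(5) by (simp add: hilbert_direct_sum_def)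
  obtain A B where A: "lower_pg_bound M p \<Lambda> A" and B: "upper_pg_bound M p \<Lambda> B"
    and meas: "\<And>x. bochner_measurable M (\<lambda>\<omega>. blinfun_apply (\<Lambda> \<omega>) x)"
    using assms(7) by (auto simp: bochner_pg_frame_def)
  have p: "0 < p" using assms(1) by simp
  show ?thesis
    using optimal_upper_bound_synthesis[OF hil assms(6) assms(1,2,4) meas A B]
      optimal_lower_bound_analysis[OF p assms(4) meas A B]
    by blast
qed

end
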